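(* Let $\Theta_A$ and $\Theta_B$ be the following weights of the two-hidden-layer ReLU network $f(x;\Theta)=W_3\,\sigma(W_2\,\sigma(W_1x+b_1)+b_2)$ with input $x\in\mathbb{R}^2$ and two units in each hidden layer: $$\Theta_A:\ W_1=\begin{bmatrix}-1&0\\0&-1\end{bmatrix},\ b_1=\begin{bmatrix}1\\0\end{bmatrix},\ W_2=\begin{bmatrix}-1&0\\0&1\end{bmatrix},\ b_2=\begin{bmatrix}1\\0\end{bmatrix},\ W_3=\begin{bmatrix}-1&-1\end{bmatrix},$$ $$\Theta_B:\ W_1=\begin{bmatrix}1&0\\0&1\end{bmatrix},\ b_1=\begin{bmatrix}0\\1\end{bmatrix},\ W_2=\begin{bmatrix}1&0\\0&-1\end{bmatrix},\ b_2=\begin{bmatrix}0\\1\end{bmatrix},\ W_3=\begin{bmatrix}-1&-1\end{bmatrix}.$$ Let $x\sim\mathrm{Uniform}([-1,1]^2)$, let $y=1$ if $x_1<0$ and $x_2>0$ and $y=0$ otherwise, and let $\mathcal{L}(\Theta)$ be the probability that the predicted label of $f(\cdot;\Theta)$ at $x$ differs from $y$, where the predicted label is $1$ if $f(x;\Theta)\ge 0$ and $0$ otherwise. Then both models fit the data perfectly, i.e. $\mathcal{L}(\Theta_A)=\mathcal{L}(\Theta_B)=0$, but no permutation of hidden units makes them linearly mode connected: for each of the four pairs $\pi=(P_1,P_2)$ of $2\times2$ permutation matrices, $$\max_{\lambda\in[0,1]}\mathcal{L}\big((1-\lambda)\Theta_A+\lambda\,\pi(\Theta_B)\big)-\tfrac12\big(\mathcal{L}(\Theta_A)+\mathcal{L}(\pi(\Theta_B))\big)>0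 .$$
   Context: $\sigma(t)=\max(t,0)$ is the ReLU, applied entrywise. For $\Theta=(W_1,b_1,W_2,b_2,W_3)$ and $\pi=(P_1,P_2)$ a pair of $2\times 2$ permutation matrices, $\pi(\Theta)=(P_1W_1,\;P_1b_1,\;P_2W_2P_1^\top,\;P_2b_2,\;W_3P_2^\top)$, which defines the same function as $\Theta$. Linear combinations of weights are taken entrywise. The loss barrier between $\Theta$ and $\Theta'$ (of approximately equal loss) is $\max_{\lambda\in[0,1]}\mathcal{L}((1-\lambda)\Theta+\lambda\Theta')-\frac12(\mathcal{L}(\Theta)+\mathcal{L}(\Theta'))$; two weight assignments are linearly mode connected when this barrier is zero. (The maximum may be read as a supremum.) *)

theory Defs
  imports "HOL-Analysis.Analysis" "HOL-Probability.Probability_Measure"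
begin

definition relu :: "real \<Rightarrow> real" where
  "relu t = max t 0"

definition relu_vec :: "real ^ 'n \<Rightarrow> real ^ 'n" where
  "relu_vec v = (\<chi> i. relu (v $ i))"

(* (W1, b1, W2, b2, W3); as a product of real vector spaces, its addition and scaling
   are the entrywise ones, so linear combinations of weights need no separate definition. *)
type_synonym weights = "(real^2^2) \<times> (real^2) \<times> (real^2^2) \<times> (real^2) \<times> (real^2^1)"

fun network :: "weights \<Rightarrow> real ^ 2 \<Rightarrow> real" where
  "network (W1, b1, W2, b2, W3) x =
     (W3 *v relu_vec (W2 *v relu_vec (W1 *v x + b1) + b2)) $ 1"

definition is_permutation_matrix :: "real ^ 'n ^ 'n \<Rightarrow> bool" where
  "is_permutation_matrix P \<longleftrightarrow>
     (\<exists>p. p permutes UNIV \<and> P = (\<chi> i j. if j = p i then 1 else 0))"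

fun permute_weights :: "(real^2^2) \<times> (real^2^2) \<Rightarrow> weights \<Rightarrow> weights" where
  "permute_weights (P1, P2) (W1, b1, W2, b2, W3) =
     (P1 ** W1, P1 *v b1, P2 ** W2 ** transpose P1, P2 *v b2, W3 ** transpose P2)"

definition predicted_label :: "weights \<Rightarrow> real ^ 2 \<Rightarrow> nat" where
  "predicted_label \<Theta> x = (if network \<Theta> x \<ge> 0 then 1 else 0)"

definition true_label :: "real ^ 2 \<Rightarrow> nat" where
  "true_label x = (if x $ 1 < 0 \<and> x $ 2 > 0 then 1 else 0)"

definition input_distribution :: "(real ^ 2) measure" where
  "input_distribution = uniform_measure lborel (cbox (vector [-1, -1]) (vector [1, 1]))"

definition loss :: "weights \<Rightarrow> real" where
  "loss \<Theta> = \<P>(x in input_distribution. predicted_label \<Theta> x \<noteq> true_label x)"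

(* The maximum over the segment is read as a supremum: the 0-1 loss need not be
   continuous along it. *)
definition loss_barrier :: "('w::real_vector \<Rightarrow> real) \<Rightarrow> 'w \<Rightarrow> 'w \<Rightarrow> real" where
  "loss_barrier L \<Theta> \<Theta>' =
     (SUP t\<in>{0..1}. L ((1 - t) *\<^sub>R \<Theta> + t *\<^sub>R \<Theta>')) - 1/2 * (L \<Theta> + L \<Theta>')"

definition linearly_mode_connected :: "('w::real_vector \<Rightarrow> real) \<Rightarrow> 'w \<Rightarrow> 'w \<Rightarrow> bool" where
  "linearly_mode_connected L \<Theta> \<Theta>' \<longleftrightarrow> loss_barrier L \<Theta> \<Theta>' = 0"

definition theta_A :: weights where
  "theta_A =
     (vector [vector [-1, 0], vector [0, -1]], vector [1, 0],
      vector [vector [-1, 0], vector [0, 1]], vector [1, 0],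
      vector [vector [-1, -1]])"

definition theta_B :: weights where
  "theta_B =
     (vector [vector [1, 0], vector [0, 1]], vector [0, 1],
      vector [vector [1, 0], vector [0, -1]], vector [0, 1],
      vector [vector [-1, -1]])"

end

theory Submission
  imports Defs
begin

text \<open>
  On the square both networks compute \<open>- relu x\<^sub>1 - relu (- x\<^sub>2)\<close>, so their labels can only be
  wrong on the coordinate axes. For every permutation the midpoint of the segment already
  fails on an open set: if \<open>P\<^sub>1\<close> is the identity, the first layer cancels and the network is
  a negative constant; if \<open>P\<^sub>1\<close> is the swap, the midpoint network is \<open>- relu (x\<^sub>1 - x\<^sub>2)\<close>
  on the square, which gives the label 1 also where \<open>0 < x\<^sub>1 < x\<^sub>2\<close>.
\<close>

abbreviation square :: "(real^2) set" where
  "square \<equiv> cbox (vector [-1, -1]) (vector [1, 1])"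

definition mislabelled :: "weights \<Rightarrow> (real^2) set" where
  "mislabelled \<Theta> = {x. predicted_label \<Theta> x \<noteq> true_label x}"

lemma mem_square_iff:
  "x \<in> square \<longleftrightarrow> -1 \<le> x $ 1 \<and> x $ 1 \<le> 1 \<and> -1 \<le> x $ 2 \<and> x $ 2 \<le> 1"
  by (auto simp: mem_box_cart forall_2)

text \<open>Writing out the sums over two units turns the continuity argument and the evaluation of
  concrete weights into plain real arithmetic.\<close>

lemma network_coords:
  "network (W1, b1, W2, b2, W3) x =
    (let h1 = relu (W1$1$1 * x$1 + W1$1$2 * x$2 + b1$1);
         h2 = relu (W1$2$1 * x$1 + W1$2$2 * x$2 + b1$2)
     in W3$1$1 * relu (W2$1$1 * h1 + W2$1$2 * h2 + b2$1)
      + W3$1$2 * relu (W2$2$1 * h1 + W2$2$2 * h2 + b2$2))"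
  by (simp add: Let_def matrix_vector_mult_def relu_vec_def sum_2)

lemma continuous_on_network: "continuous_on UNIV (network \<Theta>)"
proof (cases \<Theta>)
  case (fields W1 b1 W2 b2 W3)
  show ?thesis
    unfolding fields network_coords Let_def relu_def by (intro continuous_intros)
qed

lemma mislabelled_borel: "mislabelled \<Theta> \<in> sets borel"
proof -
  have [measurable]: "network \<Theta> \<in> borel_measurable borel"
    by (rule borel_measurable_continuous_onI[OF continuous_on_network])
  have "mislabelled \<Theta> = {x \<in> space borel. predicted_label \<Theta> x \<noteq> true_label x}"
    by (simp add: mislabelled_def)
  also have "\<dots> \<in> sets borel"
    unfolding predicted_label_def true_label_def by measurable
  finally show ?thesis .
qed

text \<open>A nonempty open set is not negligible. Finite measure matters because
  \<open>measure\<close> returns 0 on sets of infinite measure.\<close>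

lemma measure_open_pos:
  fixes U :: "'a::euclidean_space set"
  assumes "open U" "U \<noteq> {}" "U \<in> fmeasurable lborel"
  shows "measure lborel U > 0"
proof -
  have "\<not> negligible U"
    using assms open_not_negligible by blast
  then have "U \<notin> null_sets lborel"
    using null_sets_completionI by (auto simp: negligible_iff_null_sets)
  then show ?thesis
    using assms by (auto simp: null_sets_def fmeasurable_def emeasure_eq_ennreal_measure
        zero_less_measure_iff)
qed

lemma measure_square_pos: "measure lborel square > 0"
proof -
  have "box (vector [-1, -1]) (vector [1, 1]) \<noteq> ({} :: (real^2) set)"
    by (auto simp: interval_ne_empty_cart forall_2)
  then have "measure lborel (box (vector [-1, -1]) (vector [1, 1]) :: (real^2) set) > 0"
    by (intro measure_open_pos) auto
  also have "\<dots> \<le> measure lborel square"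
    by (intro measure_mono_fmeasurable box_subset_cbox) auto
  finally show ?thesis .
qed

lemma loss_eq: "loss \<Theta> = measure lborel (square \<inter> mislabelled \<Theta>) / measure lborel square"
proof -
  have "emeasure lborel square \<noteq> 0"
    using measure_square_pos by (auto simp: measure_def)
  then have "loss \<Theta> = measure (uniform_measure lborel square) (mislabelled \<Theta>)"
    by (simp add: loss_def input_distribution_def mislabelled_def)
  also have "\<dots> = measure lborel (square \<inter> mislabelled \<Theta>) / measure lborel square"
    using \<open>emeasure lborel square \<noteq> 0\<close> mislabelled_borel
      emeasure_lborel_cbox_finite[of "vector [-1, -1] :: real^2" "vector [1, 1]"]
    by (intro measure_uniform_measure) auto
  finally show ?thesis .
qed

lemma fmeasurable_square_mislabelled: "square \<inter> mislabelled \<Theta> \<in> fmeasurable lborel"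
  using mislabelled_borel by (intro fmeasurable_Int_fmeasurable) auto

text \<open>Supplies the upper bound that makes the supremum in the barrier meaningful.\<close>

lemma loss_le_1: "loss \<Theta> \<le> 1"
proof -
  have "measure lborel (square \<inter> mislabelled \<Theta>) \<le> measure lborel square"
    using fmeasurable_square_mislabelled[of \<Theta>] fmeasurable_cbox
    by (intro measure_mono_fmeasurable) (auto dest: fmeasurableD)
  then show ?thesis
    using measure_square_pos by (simp add: loss_eq)
qed

lemma loss_pos:
  assumes "open U" "U \<noteq> {}" "U \<subseteq> square \<inter> mislabelled \<Theta>"
  shows "loss \<Theta> > 0"
proof -
  have "U \<in> fmeasurable lborel"
    using assms by (intro fmeasurableI2[OF fmeasurable_cbox]) auto
  then have "0 < measure lborel U"
    using assms by (intro measure_open_pos)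
  also have "\<dots> \<le> measure lborel (square \<inter> mislabelled \<Theta>)"
    using assms fmeasurable_square_mislabelled by (intro measure_mono_fmeasurable) auto
  finally show ?thesis
    using measure_square_pos by (simp add: loss_eq)
qed

text \<open>Off the axes, the given function is 0 in the open second quadrant and negative in the
  other three, so errors are confined to two lines of measure zero.\<close>

lemma loss_eq_0:
  assumes "\<And>x. x \<in> square \<Longrightarrow> network \<Theta> x = - relu (x $ 1) - relu (- x $ 2)"
  shows "loss \<Theta> = 0"
proof -
  let ?N = "{x :: real^2. x $ 1 = 0} \<union> {x. x $ 2 = 0}"
  have "square \<inter> mislabelled \<Theta> \<subseteq> ?N"
    using assms
    by (auto simp: mislabelled_def predicted_label_def true_label_def relu_def max_def
        split: if_splits)
  moreover have "negligible ?N"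
    by (intro negligible_Un negligible_standard_hyperplane_cart)
  ultimately have "negligible (square \<inter> mislabelled \<Theta>)"
    using negligible_subset by blast
  then have "square \<inter> mislabelled \<Theta> \<in> null_sets lborel"
    using mislabelled_borel
    by (simp add: negligible_iff_null_sets null_sets_completion_iff)
  then show ?thesis
    by (simp add: loss_eq null_sets_def measure_def)
qed

text \<open>The predicted label is then 0 throughout the square, which is wrong in the open second
  quadrant.\<close>

lemma loss_pos_if_negative:
  assumes "\<And>x. x \<in> square \<Longrightarrow> network \<Theta> x < 0"
  shows "loss \<Theta> > 0"
proof (rule loss_pos)
  let ?U = "{x :: real^2. -1 < x $ 1 \<and> x $ 1 < 0 \<and> 0 < x $ 2 \<and> x $ 2 < 1}"
  show "open ?U"
    by (intro open_Collect_conj open_Collect_less continuous_intros)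
  have "vector [-1/2, 1/2] \<in> ?U" by simp
  then show "?U \<noteq> {}" by blast
  show "?U \<subseteq> square \<inter> mislabelled \<Theta>"
  proof
    fix x assume "x \<in> ?U"
    then show "x \<in> square \<inter> mislabelled \<Theta>"
      using assms[of x]
      by (auto simp: mem_square_iff mislabelled_def predicted_label_def true_label_def)
  qed
qed

lemma loss_pos_if_diagonal:
  assumes "\<And>x. x \<in> square \<Longrightarrow> network \<Theta> x = - relu (x $ 1 - x $ 2)"
  shows "loss \<Theta> > 0"
proof (rule loss_pos)
  \<comment> \<open>Here \<open>x $ 1 - x $ 2\<close> is negative, so the network outputs 0 and
    predicts 1, while \<open>x $ 1 > 0\<close> makes the true label 0.\<close>
  let ?U = "{x :: real^2. 0 < x $ 1 \<and> x $ 1 < x $ 2 \<and> x $ 2 < 1}"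
  show "open ?U"
    by (intro open_Collect_conj open_Collect_less continuous_intros)
  have "vector [1/4, 1/2] \<in> ?U" by simp
  then show "?U \<noteq> {}" by blast
  show "?U \<subseteq> square \<inter> mislabelled \<Theta>"
  proof
    fix x assume "x \<in> ?U"
    then show "x \<in> square \<inter> mislabelled \<Theta>"
      using assms[of x]
      by (auto simp: mem_square_iff mislabelled_def predicted_label_def true_label_def relu_def)
  qed
qed

lemma permutation_matrix_2_cases:
  fixes P :: "real^2^2"
  assumes "is_permutation_matrix P"
  obtains "P = vector [vector [1, 0], vector [0, 1]]"
    | "P = vector [vector [0, 1], vector [1, 0]]"
proof -
  obtain p :: "2 \<Rightarrow> 2" where p: "p permutes UNIV" "P = (\<chi> i j. if j = p i then 1 else 0)"
    using assms by (auto simp: is_permutation_matrix_def)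
  have "p 1 \<noteq> p 2"
    using permutes_inj[OF p(1)] by (auto dest: injD)
  then have "p 1 = 1 \<and> p 2 = 2 \<or> p 1 = 2 \<and> p 2 = 1"
    using exhaust_2 by metis
  then show thesis
    using that by (auto simp: p(2) vec_eq_iff forall_2)
qed

lemmas network_simps = network_coords theta_A_def theta_B_def Let_def
  matrix_vector_mult_def matrix_matrix_mult_def transpose_def sum_2

text \<open>Since \<open>x $ 1 \<le> 1\<close> on the square, the first hidden unit equals
  \<open>1 - x $ 1\<close>, and the second layer recovers \<open>relu (x $ 1)\<close> from
  it.\<close>

lemma loss_theta_A: "loss theta_A = 0"
  by (rule loss_eq_0) (simp add: network_simps mem_square_iff relu_def max_def del: network.simps)

text \<open>Permuting units leaves the function unchanged; with only four pairs, this is checked by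
  direct evaluation.\<close>

lemma loss_permute_theta_B:
  assumes "is_permutation_matrix P1" "is_permutation_matrix P2"
  shows "loss (permute_weights (P1, P2) theta_B) = 0"
  by (rule permutation_matrix_2_cases[OF assms(1)];
      rule permutation_matrix_2_cases[OF assms(2)];
      rule loss_eq_0; simp add: network_simps mem_square_iff relu_def max_def del: network.simps)

lemma loss_theta_B: "loss theta_B = 0"
  by (rule loss_eq_0) (simp add: network_simps mem_square_iff relu_def max_def del: network.simps)

lemma loss_midpoint_pos:
  assumes "is_permutation_matrix P1" "is_permutation_matrix P2"
  shows "loss ((1 - 1/2) *\<^sub>R theta_A + (1/2) *\<^sub>R permute_weights (P1, P2) theta_B) > 0"
    (is "loss ?\<Theta> > 0")
proof (rule permutation_matrix_2_cases[OF assms(1)])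
  assume P1: "P1 = vector [vector [1, 0], vector [0, 1]]"
  \<comment> \<open>The averaged \<open>W1\<close> is zero and both first-layer units are 1/2;
    either choice of \<open>P2\<close> then gives the output -1.\<close>
  have "network ?\<Theta> x < 0" if "x \<in> square" for x
    using that P1
    by (rule_tac permutation_matrix_2_cases[OF assms(2)];
        simp add: network_simps mem_square_iff relu_def max_def del: network.simps)
  then show ?thesis by (rule loss_pos_if_negative)
next
  assume P1: "P1 = vector [vector [0, 1], vector [1, 0]]"
  \<comment> \<open>With d = \<open>(x $ 1 - x $ 2) / 2\<close>, which is at most 1 on the square,
    the first layer is (1 - d, \<open>relu d\<close>). For either \<open>P2\<close> both
    second-layer units become \<open>relu d\<close>.\<close>
  have "network ?\<Theta> x = - relu (x $ 1 - x $ 2)" if "x \<in> square" for x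
    using that P1
    by (rule_tac permutation_matrix_2_cases[OF assms(2)];
        simp add: network_simps mem_square_iff relu_def max_def field_simps del: network.simps)
  then show ?thesis by (rule loss_pos_if_diagonal)
qed

lemma loss_barrier_pos:
  assumes "is_permutation_matrix P1" "is_permutation_matrix P2"
  shows "loss_barrier loss theta_A (permute_weights (P1, P2) theta_B) > 0"
proof -
  let ?\<Theta> = "\<lambda>t. (1 - t) *\<^sub>R theta_A + t *\<^sub>R permute_weights (P1, P2) theta_B"
  have "0 < loss (?\<Theta> (1/2))"
    by (rule loss_midpoint_pos[OF assms])
  also have "\<dots> \<le> (SUP t\<in>{0..1}. loss (?\<Theta> t))"
    by (rule cSUP_upper) (auto intro!: bdd_aboveI2[where M = 1] loss_le_1)
  finally show ?thesis
    \<comment> \<open>Both endpoint losses vanish, so the barrier is the supremum itself.\<close>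
    by (simp add: loss_barrier_def loss_theta_A loss_permute_theta_B[OF assms])
qed

theorem mainTheorem3:
  shows "loss theta_A = 0 \<and> loss theta_B = 0 \<and>
    (\<forall>P1 P2 :: real^2^2. is_permutation_matrix P1 \<and> is_permutation_matrix P2 \<longrightarrow>
       \<not> linearly_mode_connected loss theta_A (permute_weights (P1, P2) theta_B) \<and>
       loss_barrier loss theta_A (permute_weights (P1, P2) theta_B) > 0)"
  using loss_theta_A loss_theta_B loss_barrier_pos
  by (force simp: linearly_mode_connected_def)

end
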